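(* Let $\boldsymbol{Z}=\{z_{i,j}=(x_{i,j},y_{i,j})\in\mathbb{F}^2 : i,j\in\mathbb{N}\}$ be a node set. Then, as an identity of formal power series in $s,t$ with coefficients in $\mathbb{F}[x,y]$, $$(1-s)^{-x}(1-t)^{-y}=\sum_{m=0}^{\infty}\sum_{n=0}^{\infty}\tilde g_{m,n}((x,y);\boldsymbol{Z})\,\frac{s^m}{(1-s)^{x_{m,n}}\,m!}\,\frac{t^n}{(1-t)^{y_{m,n}}\,n!}.$$
   Context: $\mathbb{F}$ is a field of characteristic zero. For $p\in\mathbb{F}[x,y]$, the backward difference operators are $\Delta_x p(x,y)=p(x,y)-p(x-1,y)$ and $\Delta_y p(x,y)=p(x,y)-p(x,y-1)$. For $z\in\mathbb{F}^2$, $\varepsilon(z)$ denotes evaluation of a polynomial at $(x,y)=z$. Write $(i,j)\preceq(m,n)$ if $i\le m$ and $j\le n$. $\Pi^2_{m,n}$ is the space of polynomials in $\mathbb{F}[x,y]$ of degree at most $m$ in $x$ and at most $n$ in $y$. For $m,n\in\mathbb{N}$ the bivariate difference Gončarov polynomial $\tilde g_{m,n}((x,y);\boldsymbol{Z})$ is the unique polynomial in $\Pi^2_{m,n}$ satisfying $\varepsilon(z_{i,j})\Delta_x^i\Delta_y^j\tilde g_{m,n}((x,y);\boldsymbol{Z})=m!\,n!\,\delta_{m,i}\delta_{n,j}$ for all $(i,j)\preceq(m,n)$. The upper factorial is $t^{(0)}=1$, $t^{(k)}=t(t+1)\cdots(t+k-1)$, and $(1-s)^{-a}$ denotes the formal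 series $\sum_{k\ge0}a^{(k)}s^k/k!$. *)

theory Defs
  imports "HOL-Computational_Algebra.Computational_Algebra"
begin

text \<open>
  The ring \<open>\<bbbF>[x,y]\<close> is rendered as \<open>'a poly poly\<close>, read as \<open>\<bbbF>[x][y]\<close>: the inner
  indeterminate is \<open>x\<close>, the outer one is \<open>y\<close>.
\<close>

type_synonym 'a bipoly = "'a poly poly"

definition Const :: "'a::field_char_0 \<Rightarrow> 'a bipoly" where
  "Const c = [:[:c:]:]"

definition var_x :: "'a::field_char_0 bipoly" where
  "var_x = [:[:0, 1:]:]"

definition var_y :: "'a::field_char_0 bipoly" where
  "var_y = [:0, 1:]"

definition eval2 :: "'a::field_char_0 \<times> 'a \<Rightarrow> 'a bipoly \<Rightarrow> 'a" where
  "eval2 z p = poly (poly p [:snd z:]) (fst z)"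

text \<open>Here \<open>[:-1, 1:]\<close> is the polynomial \<open>x - 1\<close> and \<open>[:-1, 1:]\<close> one level up is \<open>y - 1\<close>.\<close>

definition Delta_x :: "'a::field_char_0 bipoly \<Rightarrow> 'a bipoly" where
  "Delta_x p = p - map_poly (\<lambda>q. pcompose q [:-1, 1:]) p"

definition Delta_y :: "'a::field_char_0 bipoly \<Rightarrow> 'a bipoly" where
  "Delta_y p = p - pcompose p [:-1, 1:]"

definition Pi2 :: "nat \<Rightarrow> nat \<Rightarrow> 'a::field_char_0 bipoly set" where
  "Pi2 m n = {p. (\<forall>k. degree (coeff p k) \<le> m) \<and> degree p \<le> n}"

definition goncarov :: "(nat \<Rightarrow> nat \<Rightarrow> 'a::field_char_0 \<times> 'a) \<Rightarrow> nat \<Rightarrow> nat \<Rightarrow> 'a bipoly" where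
  "goncarov z m n = (THE p. p \<in> Pi2 m n \<and>
     (\<forall>i j. i \<le> m \<and> j \<le> n \<longrightarrow>
        eval2 (z i j) ((Delta_x ^^ i) ((Delta_y ^^ j) p)) =
          fact m * fact n * of_bool (m = i) * of_bool (n = j)))"

text \<open>
  Formal power series in \<open>s\<close>, \<open>t\<close> over \<open>\<bbbF>[x,y]\<close> are rendered as \<open>\<bbbF>[x,y][[s]][[t]]\<close>:
  the coefficient of \<open>s^a t^b\<close> in \<open>f\<close> is \<open>fps_nth (fps_nth f b) a\<close>.
\<close>

type_synonym 'a bifps = "'a bipoly fps fps"

definition Scalar :: "'a::field_char_0 bipoly \<Rightarrow> 'a bifps" where
  "Scalar p = fps_const (fps_const p)"

definition var_s :: "'a::field_char_0 bifps" where
  "var_s = fps_const fps_X"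

definition var_t :: "'a::field_char_0 bifps" where
  "var_t = fps_X"

text \<open>
  The series \<open>(1-s)^(-a)\<close> and \<open>(1-t)^(-a)\<close>; \<open>pochhammer a k\<close> is the upper factorial
  \<open>a (a+1) \<cdots> (a+k-1)\<close>.
\<close>

definition neg_pow_coeff :: "'a::field_char_0 bipoly \<Rightarrow> nat \<Rightarrow> 'a bipoly" where
  "neg_pow_coeff a k = Const (1 / fact k) * pochhammer a k"

definition one_minus_s_neg_pow :: "'a::field_char_0 bipoly \<Rightarrow> 'a bifps" where
  "one_minus_s_neg_pow a = fps_const (Abs_fps (neg_pow_coeff a))"

definition one_minus_t_neg_pow :: "'a::field_char_0 bipoly \<Rightarrow> 'a bifps" where
  "one_minus_t_neg_pow a = Abs_fps (\<lambda>k. fps_const (neg_pow_coeff a k))"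

text \<open>
  Sums of infinite families of formal power series: every coefficient receives only finitely
  many nonzero contributions, and these add up to the coefficient of the sum.
  The topology that the library puts on \<open>fps\<close> is not used, since on the nested type it is
  only \<open>t\<close>-adic and ignores convergence in \<open>s\<close>.
\<close>

definition has_formal_sum :: "('i \<Rightarrow> 'a::field_char_0 bifps) \<Rightarrow> 'a bifps \<Rightarrow> bool" where
  "has_formal_sum f F \<longleftrightarrow>
     (\<forall>a b. finite {i. fps_nth (fps_nth (f i) b) a \<noteq> 0} \<and>
        fps_nth (fps_nth F b) a =
          (\<Sum>i\<in>{i. fps_nth (fps_nth (f i) b) a \<noteq> 0}. fps_nth (fps_nth (f i) b) a))"

end

theory Submission
  imports Defs
begin

text \<open>
  Backward differences turn \<open>x\<^sup>(\<^sup>a\<^sup>) y\<^sup>(\<^sup>b\<^sup>) / (a! b!)\<close> into the polynomial of the same kind with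
  smaller indices, so comparing coefficients of \<open>s\<^sup>a t\<^sup>b\<close> reduces the claim to the expansion of this
  polynomial with respect to the functionals \<open>p \<mapsto> \<epsilon>(z\<^sub>i\<^sub>j) \<Delta>\<^sub>x\<^sup>i \<Delta>\<^sub>y\<^sup>j p\<close>. These functionals separate the
  polynomials of bounded bidegree, because a polynomial both of whose differences vanish is
  constant. Solving the expansion for its leading term \<open>g\<^sub>m\<^sub>n\<close> shows by induction on \<open>m + n\<close> that the
  Goncarov polynomials exist and satisfy it.
\<close>

section \<open>Backward differences of univariate polynomials\<close>

text \<open>The coefficient ring stays general: over \<open>'a\<close> this acts on polynomials in
  x, over \<open>'a poly\<close> it is the difference in the outer variable y.\<close>

definition bdiff :: "'b::comm_ring_1 poly \<Rightarrow> 'b poly" where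
  "bdiff p = p - pcompose p [:-1, 1:]"

lemma bdiff_pCons: "bdiff (pCons a p) = pCons 0 (bdiff p) + pcompose p [:-1, 1:]"
  by (simp add: bdiff_def pcompose_pCons algebra_simps)

lemma bdiff_eq_0:
  fixes p :: "'b::idom poly"
  assumes "degree p = 0"
  shows "bdiff p = 0"
proof -
  from assms obtain c where "p = [:c:]"
    by (rule degree_eq_zeroE)
  then show ?thesis
    by (simp add: bdiff_def)
qed

text \<open>Induction with the rule x p(x) - (x-1) p(x-1) = x (p(x) - p(x-1)) + p(x-1), in which
  both summands on the right have degree at most that of p.\<close>

lemma degree_bdiff:
  fixes p :: "'b::idom poly"
  shows "degree (bdiff p) \<le> degree p - 1"
proof (induction p)
  case 0
  then show ?case by (simp add: bdiff_def)
next
  case (pCons a p)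
  show ?case
  proof (cases "degree p = 0")
    \<comment> \<open>Truncated subtraction leaves only the bound 0 for \<open>bdiff p\<close>,
      which would allow degree 1 after multiplication by x; so the vanishing of
      \<open>bdiff p\<close> is used instead.\<close>
    case True
    then show ?thesis
      by (auto simp: bdiff_pCons bdiff_eq_0 elim!: degree_eq_zeroE)
  next
    case False
    then have "degree (pCons 0 (bdiff p)) \<le> degree p"
      using pCons.IH degree_pCons_le[of 0 "bdiff p"] by linarith
    moreover have "degree (pcompose p [:-1, 1:]) \<le> degree p"
      using degree_pcompose[of p "[:-1, 1:]"] by simp
    ultimately show ?thesis
      using pCons.hyps False by (auto simp: bdiff_pCons intro: degree_add_le)
  qed
qed

text \<open>Invariance under x -> x - 1 makes p take the value p(0) at every nonpositive integer. In
  characteristic zero these are infinitely many roots of p - p(0).\<close>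

lemma degree_eq_0_if_bdiff_eq_0:
  fixes p :: "'b::{idom, ring_char_0} poly"
  assumes "bdiff p = 0"
  shows "degree p = 0"
proof -
  have shift: "poly p (x - 1) = poly p x" for x
  proof -
    have "poly (bdiff p) x = 0"
      by (simp add: assms)
    then show ?thesis
      by (simp add: bdiff_def poly_pcompose)
  qed
  have "poly p (- of_nat n) = poly p 0" for n
  proof (induction n)
    case (Suc n)
    have "- of_nat (Suc n) = - of_nat n - (1 :: 'b)"
      by simp
    with Suc show ?case
      by (simp only: shift)
  qed simp
  then have "range (\<lambda>n. - of_nat n) \<subseteq> {x. poly (p - [:poly p 0:]) x = 0}"
    by auto
  moreover have "infinite (range (\<lambda>n. - of_nat n :: 'b))"
    by (intro range_inj_infinite) (simp add: inj_on_def)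
  ultimately have "p - [:poly p 0:] = 0"
    using poly_roots_finite finite_subset by metis
  then show ?thesis
    by (metis degree_pCons_0 right_minus_eq)
qed

section \<open>Backward differences of bivariate polynomials\<close>

text \<open>The shifts are ring homomorphisms while the differences are not, so product computations
  are done for shifts and transferred through Delta = 1 - shift.\<close>

definition shift_x :: "'a::field_char_0 bipoly \<Rightarrow> 'a bipoly" where
  "shift_x p = map_poly (\<lambda>q. pcompose q [:-1, 1:]) p"

definition shift_y :: "'a::field_char_0 bipoly \<Rightarrow> 'a bipoly" where
  "shift_y p = pcompose p [:-1, 1:]"

lemma Delta_x_eq: "Delta_x p = p - shift_x p"
  by (simp add: Delta_x_def shift_x_def)

lemma Delta_y_eq: "Delta_y p = p - shift_y p"
  by (simp add: Delta_y_def shift_y_def)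

lemma Delta_y_bdiff: "Delta_y p = bdiff p"
  by (simp add: Delta_y_def bdiff_def)

lemma coeff_shift_x: "coeff (shift_x p) k = pcompose (coeff p k) [:-1, 1:]"
  by (simp add: shift_x_def coeff_map_poly)

lemma coeff_Delta_x: "coeff (Delta_x p) k = bdiff (coeff p k)"
  by (simp add: Delta_x_eq coeff_shift_x bdiff_def)

lemma shift_x_0 [simp]: "shift_x 0 = 0"
  and shift_y_0 [simp]: "shift_y 0 = 0"
  by (simp_all add: shift_x_def shift_y_def)

lemma shift_x_add: "shift_x (p + q) = shift_x p + shift_x q"
  by (rule poly_eqI) (simp add: coeff_shift_x pcompose_add)

lemma shift_x_diff: "shift_x (p - q) = shift_x p - shift_x q"
  by (rule poly_eqI) (simp add: coeff_shift_x pcompose_diff)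

lemma shift_x_mult: "shift_x (p * q) = shift_x p * shift_x q"
  by (rule poly_eqI) (simp add: coeff_shift_x coeff_mult pcompose_sum pcompose_mult)

lemma shift_x_pCons: "shift_x (pCons a p) = pCons (pcompose a [:-1, 1:]) (shift_x p)"
  by (rule poly_eqI) (simp add: coeff_shift_x coeff_pCons split: nat.splits)

lemma shift_y_add: "shift_y (p + q) = shift_y p + shift_y q"
  by (simp add: shift_y_def pcompose_add)

lemma shift_y_diff: "shift_y (p - q) = shift_y p - shift_y q"
  by (simp add: shift_y_def pcompose_diff)

lemma shift_y_mult: "shift_y (p * q) = shift_y p * shift_y q"
  by (simp add: shift_y_def pcompose_mult)

lemma shift_y_pCons: "shift_y (pCons a p) = [:a:] + (pCons 0 (shift_y p) - shift_y p)"
  by (simp add: shift_y_def pcompose_pCons)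

lemma shift_x_shift_y: "shift_x (shift_y p) = shift_y (shift_x p)"
  by (induction p) (simp_all add: shift_x_pCons shift_y_pCons shift_x_add shift_x_diff)

lemma Delta_x_Delta_y: "Delta_x (Delta_y p) = Delta_y (Delta_x p)"
  by (simp add: Delta_x_eq Delta_y_eq shift_x_diff shift_y_diff shift_x_shift_y)

text \<open>This lets a single x-difference pass through the y-differences, so that the functional
  of index (i, j) on \<open>Delta_x p\<close> becomes the one of index (i+1, j) on p.\<close>

lemma Delta_y_funpow_Delta_x: "(Delta_y ^^ j) (Delta_x p) = Delta_x ((Delta_y ^^ j) p)"
  by (induction j) (simp_all add: Delta_x_Delta_y)

section \<open>Upper factorials under shifts and differences\<close>

lemma Const_1: "Const 1 = 1"
  by (simp add: Const_def one_pCons)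

lemma Const_mult: "Const (a * b) = Const a * Const b"
  by (simp add: Const_def)

lemma Const_of_nat: "Const (of_nat n) = of_nat n"
  by (simp add: Const_def of_nat_poly)

lemma shift_x_Const: "shift_x (Const c) = Const c"
  and shift_y_Const: "shift_y (Const c) = Const c"
  by (simp_all add: Const_def shift_x_pCons shift_y_pCons)

lemma shift_x_1: "shift_x 1 = 1"
  and shift_y_1: "shift_y 1 = 1"
  using shift_x_Const[of 1] shift_y_Const[of 1] by (simp_all add: Const_1)

lemma shift_x_var_x: "shift_x var_x = var_x - 1"
  and shift_x_var_y: "shift_x var_y = var_y"
  and shift_y_var_x: "shift_y var_x = var_x"
  and shift_y_var_y: "shift_y var_y = var_y - 1"
  by (simp_all add: var_x_def var_y_def shift_x_pCons shift_y_pCons pcompose_pCons one_pCons)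

lemma shift_x_pochhammer: "shift_x (pochhammer p k) = pochhammer (shift_x p) k"
  by (induction k)
    (simp_all add: shift_x_1 pochhammer_Suc shift_x_mult shift_x_add shift_x_Const
      flip: Const_of_nat)

lemma shift_y_pochhammer: "shift_y (pochhammer p k) = pochhammer (shift_y p) k"
  by (induction k)
    (simp_all add: shift_y_1 pochhammer_Suc shift_y_mult shift_y_add shift_y_Const
      flip: Const_of_nat)

lemma shift_x_neg_pow_coeff: "shift_x (neg_pow_coeff p k) = neg_pow_coeff (shift_x p) k"
  by (simp add: neg_pow_coeff_def shift_x_mult shift_x_Const shift_x_pochhammer)

lemma shift_y_neg_pow_coeff: "shift_y (neg_pow_coeff p k) = neg_pow_coeff (shift_y p) k"
  by (simp add: neg_pow_coeff_def shift_y_mult shift_y_Const shift_y_pochhammer)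

text \<open>Splitting the last factor off p^(k+1) and the first off (p-1)^(k+1) leaves the common
  factor p^(k). What remains is (p + k) - (p - 1) = k + 1, which the factorial absorbs.\<close>

lemma neg_pow_coeff_diff:
  "neg_pow_coeff p (Suc k) - neg_pow_coeff (p - 1) (Suc k) = neg_pow_coeff p k"
proof -
  have "pochhammer p (Suc k) - pochhammer (p - 1) (Suc k) = of_nat (Suc k) * pochhammer p k"
    by (simp add: pochhammer_Suc[of p] pochhammer_rec[of "p - 1"] algebra_simps)
  then have "neg_pow_coeff p (Suc k) - neg_pow_coeff (p - 1) (Suc k) =
      Const (1 / fact (Suc k)) * (Const (of_nat (Suc k)) * pochhammer p k)"
    unfolding neg_pow_coeff_def right_diff_distrib[symmetric] Const_of_nat by (rule arg_cong)
  also have "\<dots> = Const (1 / fact (Suc k) * of_nat (Suc k)) * pochhammer p k"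
    by (simp only: Const_mult mult.assoc)
  also have "1 / fact (Suc k) * of_nat (Suc k) = (1 / fact k :: 'a)"
    by (simp add: divide_simps del: of_nat_Suc)
  finally show ?thesis
    by (simp add: neg_pow_coeff_def)
qed

text \<open>A factor fixed by the shift behaves like a scalar; it will be the y-part of the
  product.\<close>

lemma Delta_x_funpow_neg_pow_coeff:
  assumes "i \<le> a" "shift_x q = q"
  shows "(Delta_x ^^ i) (neg_pow_coeff var_x a * q) = neg_pow_coeff var_x (a - i) * q"
  using assms(1)
proof (induction i)
  case (Suc i)
  then have "a - i = Suc (a - Suc i)"
    by simp
  with Suc show ?case
    by (simp add: Delta_x_eq shift_x_mult shift_x_neg_pow_coeff shift_x_var_x assms(2)
        neg_pow_coeff_diff flip: left_diff_distrib)
qed simp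

lemma Delta_y_funpow_neg_pow_coeff:
  assumes "j \<le> b" "shift_y q = q"
  shows "(Delta_y ^^ j) (q * neg_pow_coeff var_y b) = q * neg_pow_coeff var_y (b - j)"
  using assms(1)
proof (induction j)
  case (Suc j)
  then have "b - j = Suc (b - Suc j)"
    by simp
  with Suc show ?case
    by (simp add: Delta_y_eq shift_y_mult shift_y_neg_pow_coeff shift_y_var_y assms(2)
        neg_pow_coeff_diff flip: right_diff_distrib)
qed simp

section \<open>Bidegree\<close>

lemma Pi2_add: "p \<in> Pi2 m n \<Longrightarrow> q \<in> Pi2 m n \<Longrightarrow> p + q \<in> Pi2 m n"
  by (auto simp: Pi2_def intro: degree_add_le)

lemma Pi2_diff: "p \<in> Pi2 m n \<Longrightarrow> q \<in> Pi2 m n \<Longrightarrow> p - q \<in> Pi2 m n"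
  by (auto simp: Pi2_def intro: degree_diff_le)

lemma Pi2_0: "0 \<in> Pi2 m n"
  by (simp add: Pi2_def)

lemma Pi2_sum: "(\<And>i. i \<in> I \<Longrightarrow> f i \<in> Pi2 m n) \<Longrightarrow> (\<Sum>i\<in>I. f i) \<in> Pi2 m n"
  by (induction I rule: infinite_finite_induct) (auto intro: Pi2_add Pi2_0)

lemma Pi2_mono: "p \<in> Pi2 m n \<Longrightarrow> m \<le> m' \<Longrightarrow> n \<le> n' \<Longrightarrow> p \<in> Pi2 m' n'"
  by (auto simp: Pi2_def intro: order_trans)

lemma Pi2_mult:
  assumes "p \<in> Pi2 m n" "q \<in> Pi2 m' n'"
  shows "p * q \<in> Pi2 (m + m') (n + n')"
proof -
  have "degree (coeff (p * q) k) \<le> m + m'" for k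
    unfolding coeff_mult using assms
    by (intro degree_sum_le order_trans[OF degree_mult_le] add_mono) (auto simp: Pi2_def)
  moreover have "degree (p * q) \<le> n + n'"
    using assms by (intro order_trans[OF degree_mult_le] add_mono) (auto simp: Pi2_def)
  ultimately show ?thesis
    by (simp add: Pi2_def)
qed

lemma Const_Pi2: "Const c \<in> Pi2 m n"
  by (auto simp: Pi2_def Const_def coeff_pCons split: nat.splits)

lemma Pi2_Const_mult: "p \<in> Pi2 m n \<Longrightarrow> Const c * p \<in> Pi2 m n"
  using Pi2_mult[OF Const_Pi2[of c 0 0]] by fastforce

lemma neg_pow_coeff_Pi2:
  assumes "p \<in> Pi2 m n"
  shows "neg_pow_coeff p k \<in> Pi2 (k * m) (k * n)"
proof -
  have "pochhammer p k \<in> Pi2 (k * m) (k * n)"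
  proof (induction k)
    case 0
    then show ?case
      using Const_Pi2[of 1] by (simp add: Const_1)
  next
    case (Suc k)
    have "p + of_nat k \<in> Pi2 m n"
      using assms by (auto intro: Pi2_add Const_Pi2 simp flip: Const_of_nat)
    from Pi2_mult[OF Suc this] show ?case
      by (simp add: pochhammer_Suc add.commute)
  qed
  then show ?thesis
    unfolding neg_pow_coeff_def by (rule Pi2_Const_mult)
qed

lemma var_x_Pi2: "var_x \<in> Pi2 1 0"
  and var_y_Pi2: "var_y \<in> Pi2 0 1"
  by (auto simp: Pi2_def var_x_def var_y_def coeff_pCons split: nat.splits)

lemma neg_pow_coeff_mult_Pi2: "neg_pow_coeff var_x m * neg_pow_coeff var_y n \<in> Pi2 m n"
  using Pi2_mult[OF neg_pow_coeff_Pi2[OF var_x_Pi2] neg_pow_coeff_Pi2[OF var_y_Pi2], of m n]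
  by simp

lemma Delta_x_Pi2:
  assumes "p \<in> Pi2 m n"
  shows "Delta_x p \<in> Pi2 (m - 1) n"
proof -
  have "degree (coeff (Delta_x p) k) \<le> m - 1" for k
    using degree_bdiff[of "coeff p k"] assms
    by (auto simp: coeff_Delta_x Pi2_def intro: order_trans diff_le_mono)
  moreover have "degree (Delta_x p) \<le> n"
    using assms by (intro degree_le) (auto simp: coeff_Delta_x Pi2_def coeff_eq_0 bdiff_def)
  ultimately show ?thesis
    by (simp add: Pi2_def)
qed

text \<open>Substituting y - 1 for y only forms sums and differences of the coefficients, which are
  polynomials in x, so the degree in x cannot grow.\<close>

lemma degree_coeff_shift_y:
  assumes "\<And>k. degree (coeff p k) \<le> m"
  shows "degree (coeff (shift_y p) k) \<le> m"
  using assms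
proof (induction p arbitrary: k)
  case (pCons a p)
  have "degree (coeff p i) \<le> m" for i
    using pCons.prems[of "Suc i"] by simp
  then have "degree (coeff (shift_y p) i) \<le> m" for i
    by (rule pCons.IH)
  moreover have "degree a \<le> m"
    using pCons.prems[of 0] by simp
  ultimately show ?case
    by (auto simp: shift_y_pCons coeff_pCons split: nat.splits
        intro!: degree_add_le degree_diff_le)
qed simp

lemma Delta_y_Pi2:
  assumes "p \<in> Pi2 m n"
  shows "Delta_y p \<in> Pi2 m (n - 1)"
proof -
  have "degree (coeff (Delta_y p) k) \<le> m" for k
    using assms by (auto simp: Delta_y_eq Pi2_def intro: degree_diff_le degree_coeff_shift_y)
  moreover have "degree (Delta_y p) \<le> n - 1"
    using degree_bdiff[of p] assms
    by (auto simp: Delta_y_bdiff Pi2_def intro: order_trans diff_le_mono)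
  ultimately show ?thesis
    by (simp add: Pi2_def)
qed

lemma Delta_x_eq_0: "p \<in> Pi2 0 n \<Longrightarrow> Delta_x p = 0"
  by (rule poly_eqI) (simp add: coeff_Delta_x Pi2_def bdiff_eq_0)

lemma Delta_y_eq_0: "p \<in> Pi2 m 0 \<Longrightarrow> Delta_y p = 0"
  by (simp add: Delta_y_bdiff Pi2_def bdiff_eq_0)

lemma Delta_x_funpow_0: "(Delta_x ^^ i) 0 = 0"
  and Delta_y_funpow_0: "(Delta_y ^^ j) 0 = 0"
  by (induction i, simp_all add: Delta_x_eq, induction j, simp_all add: Delta_y_eq)

lemma Delta_x_funpow_eq_0:
  assumes "p \<in> Pi2 m n" "m < i"
  shows "(Delta_x ^^ i) p = 0"
  using assms
proof (induction i arbitrary: p m)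
  case (Suc i)
  show ?case
  proof (cases m)
    \<comment> \<open>Here the bound \<open>m - 1\<close> no longer decreases; instead the first
      difference already gives 0.\<close>
    case 0
    with Suc.prems show ?thesis
      by (simp add: funpow_Suc_right Delta_x_eq_0 Delta_x_funpow_0 del: funpow.simps)
  next
    case (Suc m')
    with Suc.prems Suc.IH[OF Delta_x_Pi2[of p m n]] show ?thesis
      by (simp add: funpow_Suc_right del: funpow.simps)
  qed
qed simp

lemma Delta_y_funpow_eq_0:
  assumes "p \<in> Pi2 m n" "n < j"
  shows "(Delta_y ^^ j) p = 0"
  using assms
proof (induction j arbitrary: p n)
  case (Suc j)
  show ?case
  proof (cases n)
    case 0
    with Suc.prems show ?thesis
      by (simp add: funpow_Suc_right Delta_y_eq_0 Delta_y_funpow_0 del: funpow.simps)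
  next
    case (Suc n')
    with Suc.prems Suc.IH[OF Delta_y_Pi2[of p m n]] show ?thesis
      by (simp add: funpow_Suc_right del: funpow.simps)
  qed
qed simp

lemma Delta_y_funpow_Pi2: "p \<in> Pi2 m n \<Longrightarrow> (Delta_y ^^ j) p \<in> Pi2 m n"
  by (induction j) (auto dest: Delta_y_Pi2 intro: Pi2_mono)

section \<open>The interpolation functionals\<close>

lemma eval2_add: "eval2 w (p + q) = eval2 w p + eval2 w q"
  and eval2_diff: "eval2 w (p - q) = eval2 w p - eval2 w q"
  and eval2_mult: "eval2 w (p * q) = eval2 w p * eval2 w q"
  and eval2_0: "eval2 w 0 = 0"
  and eval2_Const: "eval2 w (Const c) = c"
  and eval2_var_x: "eval2 w var_x = fst w"
  and eval2_var_y: "eval2 w var_y = snd w"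
  by (simp_all add: eval2_def Const_def var_x_def var_y_def)

lemma eval2_pochhammer: "eval2 w (pochhammer p k) = pochhammer (eval2 w p) k"
proof (induction k)
  case 0
  then show ?case
    using eval2_Const[of w 1] by (simp add: Const_1)
qed (simp_all add: pochhammer_Suc eval2_mult eval2_add eval2_Const flip: Const_of_nat)

lemma eval2_neg_pow_coeff:
  "eval2 w (neg_pow_coeff p k) = pochhammer (eval2 w p) k / fact k"
  by (simp add: neg_pow_coeff_def eval2_mult eval2_Const eval2_pochhammer)

lemma Const_add: "Const (a + b) = Const a + Const b"
  by (simp add: Const_def)

lemma neg_pow_coeff_Const: "neg_pow_coeff (Const c) k = Const (pochhammer c k / fact k)"
proof -
  have "pochhammer (Const c) k = Const (pochhammer c k)"
    by (induction k) (simp_all add: pochhammer_Suc Const_1 Const_mult Const_add Const_of_nat)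
  then show ?thesis
    by (simp add: neg_pow_coeff_def flip: Const_mult)
qed

text \<open>The node varies with the order of the difference, so these are linear functionals and
  not derivatives at one common point.\<close>

definition diff_eval :: "(nat \<Rightarrow> nat \<Rightarrow> 'a::field_char_0 \<times> 'a) \<Rightarrow> nat \<Rightarrow> nat \<Rightarrow> 'a bipoly \<Rightarrow> 'a"
  where "diff_eval z i j p = eval2 (z i j) ((Delta_x ^^ i) ((Delta_y ^^ j) p))"

lemma Delta_x_funpow_diff: "(Delta_x ^^ i) (p - q) = (Delta_x ^^ i) p - (Delta_x ^^ i) q"
  by (induction i) (simp_all add: Delta_x_eq shift_x_diff)

lemma Delta_y_funpow_diff: "(Delta_y ^^ i) (p - q) = (Delta_y ^^ i) p - (Delta_y ^^ i) q"
  by (induction i) (simp_all add: Delta_y_eq shift_y_diff)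

lemma Delta_x_funpow_add: "(Delta_x ^^ i) (p + q) = (Delta_x ^^ i) p + (Delta_x ^^ i) q"
  by (induction i) (simp_all add: Delta_x_eq shift_x_add)

lemma Delta_y_funpow_add: "(Delta_y ^^ i) (p + q) = (Delta_y ^^ i) p + (Delta_y ^^ i) q"
  by (induction i) (simp_all add: Delta_y_eq shift_y_add)

lemma Delta_x_funpow_Const_mult: "(Delta_x ^^ i) (Const c * p) = Const c * (Delta_x ^^ i) p"
  by (induction i) (simp_all add: Delta_x_eq shift_x_mult shift_x_Const right_diff_distrib)

lemma Delta_y_funpow_Const_mult: "(Delta_y ^^ i) (Const c * p) = Const c * (Delta_y ^^ i) p"
  by (induction i) (simp_all add: Delta_y_eq shift_y_mult shift_y_Const right_diff_distrib)

lemma diff_eval_diff: "diff_eval z i j (p - q) = diff_eval z i j p - diff_eval z i j q"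
  by (simp add: diff_eval_def Delta_x_funpow_diff Delta_y_funpow_diff eval2_diff)

lemma diff_eval_Const_mult: "diff_eval z i j (Const c * p) = c * diff_eval z i j p"
  by (simp add: diff_eval_def Delta_x_funpow_Const_mult Delta_y_funpow_Const_mult
      eval2_mult eval2_Const)

lemma diff_eval_sum: "diff_eval z i j (\<Sum>k\<in>K. f k) = (\<Sum>k\<in>K. diff_eval z i j (f k))"
  by (induction K rule: infinite_finite_induct)
    (simp_all add: diff_eval_def Delta_x_funpow_add Delta_y_funpow_add eval2_add
      Delta_x_funpow_0 Delta_y_funpow_0 eval2_0)

lemma diff_eval_eq_0:
  assumes "p \<in> Pi2 m n" "\<not> (i \<le> m \<and> j \<le> n)"
  shows "diff_eval z i j p = 0"
proof (cases "j \<le> n")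
  case True
  with assms Delta_x_funpow_eq_0[OF Delta_y_funpow_Pi2[OF assms(1)]] show ?thesis
    by (simp add: diff_eval_def eval2_0)
next
  case False
  with assms Delta_y_funpow_eq_0[OF assms(1)] show ?thesis
    by (simp add: diff_eval_def eval2_0 Delta_x_funpow_0)
qed

text \<open>The value is the coefficient of s^(a-i) t^(b-j) in (1-s)^(-x_ij) (1-t)^(-y_ij). This is
  what links the polynomial expansion to the generating series.\<close>

lemma diff_eval_neg_pow_coeff:
  fixes z :: "nat \<Rightarrow> nat \<Rightarrow> 'a::field_char_0 \<times> 'a"
  assumes "i \<le> a" "j \<le> b"
  shows "diff_eval z i j (neg_pow_coeff var_x a * neg_pow_coeff var_y b) =
    (pochhammer (fst (z i j)) (a - i) / fact (a - i)) *
    (pochhammer (snd (z i j)) (b - j) / fact (b - j))"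
proof -
  have "(Delta_y ^^ j) (neg_pow_coeff var_x a * neg_pow_coeff var_y b :: 'a bipoly) =
      neg_pow_coeff var_x a * neg_pow_coeff var_y (b - j)"
    using assms(2)
    by (rule Delta_y_funpow_neg_pow_coeff) (simp add: shift_y_neg_pow_coeff shift_y_var_x)
  moreover have "(Delta_x ^^ i)
      (neg_pow_coeff var_x a * neg_pow_coeff var_y (b - j) :: 'a bipoly) =
      neg_pow_coeff var_x (a - i) * neg_pow_coeff var_y (b - j)"
    using assms(1)
    by (rule Delta_x_funpow_neg_pow_coeff) (simp add: shift_x_neg_pow_coeff shift_x_var_y)
  ultimately show ?thesis
    by (simp add: diff_eval_def eval2_mult eval2_neg_pow_coeff eval2_var_x eval2_var_y)
qed

text \<open>The y-difference removes y, the x-difference then removes x from the remaining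
  coefficient, and one evaluation determines the constant.\<close>

lemma eq_0_if_Delta_eq_0:
  assumes "Delta_x p = 0" "Delta_y p = 0" "eval2 w p = 0"
  shows "p = 0"
proof -
  have "degree p = 0"
    using assms(2) by (simp add: Delta_y_bdiff degree_eq_0_if_bdiff_eq_0)
  then obtain q where q: "p = [:q:]"
    by (rule degree_eq_zeroE)
  have "bdiff q = 0"
    using coeff_Delta_x[of p 0] assms(1) q by simp
  then obtain c where "q = [:c:]"
    using degree_eq_0_if_bdiff_eq_0 degree_eq_zeroE by blast
  with q assms(3) show ?thesis
    by (simp add: eval2_def)
qed

text \<open>Uniqueness of interpolation. Both differences of p satisfy the same hypothesis with a
  smaller bidegree and reindexed nodes, which is why the induction generalises over z. The node of
  index (0, 0) then settles the constant.\<close>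

lemma eq_0_if_diff_eval_eq_0:
  assumes "p \<in> Pi2 m n" "\<And>i j. i \<le> m \<Longrightarrow> j \<le> n \<Longrightarrow> diff_eval z i j p = 0"
  shows "p = 0"
  using assms
proof (induction "m + n" arbitrary: m n p z rule: less_induct)
  case less
  have "Delta_x p = 0"
  proof (cases m)
    case 0
    with less.prems(1) show ?thesis
      by (simp add: Delta_x_eq_0)
  next
    case (Suc m')
    show ?thesis
    proof (rule less.hyps)
      show "m' + n < m + n"
        by (simp add: Suc)
      show "Delta_x p \<in> Pi2 m' n"
        using Delta_x_Pi2[OF less.prems(1)] Suc by simp
      show "diff_eval (\<lambda>i. z (Suc i)) i j (Delta_x p) = 0" if "i \<le> m'" "j \<le> n" for i j
        using less.prems(2)[of "Suc i" j] that Suc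
        by (simp add: diff_eval_def Delta_y_funpow_Delta_x funpow_swap1)
    qed
  qed
  moreover have "Delta_y p = 0"
  proof (cases n)
    case 0
    with less.prems(1) show ?thesis
      by (simp add: Delta_y_eq_0)
  next
    case (Suc n')
    show ?thesis
    proof (rule less.hyps)
      show "m + n' < m + n"
        by (simp add: Suc)
      show "Delta_y p \<in> Pi2 m n'"
        using Delta_y_Pi2[OF less.prems(1)] Suc by simp
      show "diff_eval (\<lambda>i j. z i (Suc j)) i j (Delta_y p) = 0" if "i \<le> m" "j \<le> n'" for i j
        using less.prems(2)[of i "Suc j"] that Suc
        by (simp add: diff_eval_def funpow_swap1)
    qed
  qed
  moreover have "eval2 (z 0 0) p = 0"
    using less.prems(2)[of 0 0] by (simp add: diff_eval_def)
  ultimately show ?case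
    by (rule eq_0_if_Delta_eq_0)
qed

section \<open>Goncarov polynomials\<close>

text \<open>Uniqueness discharges the description operator: exhibiting one polynomial with the
  required values suffices.\<close>

lemma goncarov_eqI:
  assumes "p \<in> Pi2 m n"
    and "\<And>i j. i \<le> m \<Longrightarrow> j \<le> n \<Longrightarrow>
      diff_eval z i j p = fact m * fact n * of_bool (m = i) * of_bool (n = j)"
  shows "goncarov z m n = p"
  unfolding goncarov_def diff_eval_def[symmetric]
proof (rule the_equality)
  fix q
  assume q: "q \<in> Pi2 m n \<and> (\<forall>i j. i \<le> m \<and> j \<le> n \<longrightarrow>
    diff_eval z i j q = fact m * fact n * of_bool (m = i) * of_bool (n = j))"
  have "q - p = 0"
    by (rule eq_0_if_diff_eval_eq_0[where m = m and n = n and z = z])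
      (use q assms in \<open>auto intro: Pi2_diff simp: diff_eval_diff\<close>)
  then show "q = p"
    by simp
qed (use assms in auto)

text \<open>The three claims are proved in one induction: the properties of the lower polynomials
  yield a candidate for the next one, and its defining equation, rearranged, is the
  expansion.\<close>

lemma goncarov_properties:
  fixes z :: "nat \<Rightarrow> nat \<Rightarrow> 'a::field_char_0 \<times> 'a"
  defines "d \<equiv> \<lambda>m n i j. diff_eval z i j (neg_pow_coeff var_x m * neg_pow_coeff var_y n)"
  shows goncarov_Pi2: "goncarov z m n \<in> Pi2 m n"
    and diff_eval_goncarov:
      "diff_eval z k l (goncarov z m n) = fact m * fact n * of_bool (m = k) * of_bool (n = l)"
    and neg_pow_coeff_expansion:
      "neg_pow_coeff var_x m * neg_pow_coeff var_y n =
        (\<Sum>(i, j)\<in>{..m} \<times> {..n}. Const (d m n i j / (fact i * fact j)) * goncarov z i j)"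
proof -
  have "goncarov z m n \<in> Pi2 m n \<and>
    (\<forall>k l. diff_eval z k l (goncarov z m n) =
      fact m * fact n * of_bool (m = k) * of_bool (n = l)) \<and>
    neg_pow_coeff var_x m * neg_pow_coeff var_y n =
      (\<Sum>(i, j)\<in>{..m} \<times> {..n}. Const (d m n i j / (fact i * fact j)) * goncarov z i j)"
  proof (induction "m + n" arbitrary: m n rule: less_induct)
    case less
    let ?b = "neg_pow_coeff var_x m * neg_pow_coeff var_y n"
    let ?f = "fact m * fact n :: 'a"
    define I where "I = {..m} \<times> {..n} - {(m, n)}"
    define S where
      "S = (\<Sum>(i, j)\<in>I. Const (d m n i j / (fact i * fact j)) * goncarov z i j)"
    \<comment> \<open>The expansion solved for its term of index (m, n), whose coefficient is 1/(m!
      n!).\<close>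
    define p where "p = Const ?f * (?b - S)"
    have IH: "goncarov z i j \<in> Pi2 i j"
        "diff_eval z k l (goncarov z i j) = fact i * fact j * of_bool (i = k) * of_bool (j = l)"
      if "(i, j) \<in> I" for i j k l
    proof -
      have "i + j < m + n"
        using that by (auto simp: I_def)
      from less[OF this] show "goncarov z i j \<in> Pi2 i j"
        "diff_eval z k l (goncarov z i j) = fact i * fact j * of_bool (i = k) * of_bool (j = l)"
        by auto
    qed
    have "S \<in> Pi2 m n"
      unfolding S_def using IH(1)
      by (intro Pi2_sum) (auto simp: I_def intro!: Pi2_Const_mult intro: Pi2_mono)
    then have p: "p \<in> Pi2 m n"
      unfolding p_def by (intro Pi2_Const_mult Pi2_diff neg_pow_coeff_mult_Pi2)
    \<comment> \<open>The functional of index (k, l) selects the one summand with that index, and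
      its factorials cancel. Hence S has the same values as \<open>?b\<close> on I and the value 0
      at (m, n).\<close>
    have S: "diff_eval z k l S = (if (k, l) \<in> I then d m n k l else 0)" for k l
    proof -
      have "diff_eval z k l S =
          (\<Sum>x\<in>I. case x of (i, j) \<Rightarrow> d m n i j * of_bool (i = k) * of_bool (j = l))"
        unfolding S_def diff_eval_sum
        by (intro sum.cong) (auto simp: diff_eval_Const_mult IH(2))
      also have "\<dots> = (\<Sum>x\<in>I. if x = (k, l) then d m n k l else 0)"
        by (intro sum.cong) auto
      finally show ?thesis
        by (simp add: I_def)
    qed
    have "d m n m n = 1"
      by (simp add: d_def diff_eval_neg_pow_coeff)
    then have eval_p: "diff_eval z k l p = ?f * of_bool (m = k) * of_bool (n = l)"
      if "k \<le> m" "l \<le> n" for k l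
      using that by (auto simp: p_def diff_eval_Const_mult diff_eval_diff S I_def d_def)
    have g: "goncarov z m n = p"
      using p eval_p by (rule goncarov_eqI)
    have "?b = Const (1 / ?f) * p + S"
      by (simp add: p_def Const_1 flip: mult.assoc Const_mult)
    also have "\<dots> = (\<Sum>(i, j)\<in>insert (m, n) I.
        Const (d m n i j / (fact i * fact j)) * goncarov z i j)"
      unfolding S_def using \<open>d m n m n = 1\<close>
      by (subst sum.insert) (auto simp: I_def g)
    also have "insert (m, n) I = {..m} \<times> {..n}"
      by (auto simp: I_def)
    finally have "?b = (\<Sum>(i, j)\<in>{..m} \<times> {..n}.
        Const (d m n i j / (fact i * fact j)) * goncarov z i j)" .
    \<comment> \<open>Beyond the bidegree the functionals vanish by degree, so the values are known
      for all k and l; the next induction step can then evaluate S without comparing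
      indices.\<close>
    moreover have "diff_eval z k l p = ?f * of_bool (m = k) * of_bool (n = l)" for k l
    proof (cases "k \<le> m \<and> l \<le> n")
      case True
      then show ?thesis
        by (simp only: eval_p)
    next
      case False
      then show ?thesis
        using diff_eval_eq_0[OF p, of k l] by auto
    qed
    ultimately show ?case
      using p unfolding g by blast
  qed
  note main = this
  show "goncarov z m n \<in> Pi2 m n"
    by (rule main[THEN conjunct1])
  show "diff_eval z k l (goncarov z m n) = fact m * fact n * of_bool (m = k) * of_bool (n = l)"
    by (rule main[THEN conjunct2, THEN conjunct1, rule_format])
  show "neg_pow_coeff var_x m * neg_pow_coeff var_y n =
      (\<Sum>(i, j)\<in>{..m} \<times> {..n}. Const (d m n i j / (fact i * fact j)) * goncarov z i j)"
    by (rule main[THEN conjunct2, THEN conjunct2])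
qed

section \<open>Comparison of coefficients\<close>

lemma nth_goncarov_term:
  "fps_nth (fps_nth (Scalar g
       * (var_s ^ m * one_minus_s_neg_pow (Const u) * Scalar (Const c))
       * (var_t ^ n * one_minus_t_neg_pow (Const v) * Scalar (Const c'))) b) a =
    (if m \<le> a \<and> n \<le> b then
      Const ((pochhammer u (a - m) / fact (a - m)) * (pochhammer v (b - n) / fact (b - n))
        * (c * c')) * g
     else 0)"
proof -
  \<comment> \<open>The factors are sorted into a series in s that is constant in t and a series in
    t, so that each power of a variable is a plain index shift.\<close>
  have "Scalar g
       * (var_s ^ m * one_minus_s_neg_pow (Const u) * Scalar (Const c))
       * (var_t ^ n * one_minus_t_neg_pow (Const v) * Scalar (Const c')) =
     fps_const (fps_X ^ m * (Abs_fps (neg_pow_coeff (Const u)) * fps_const (g * Const (c * c')))) *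
       (fps_X ^ n * Abs_fps (\<lambda>k. fps_const (neg_pow_coeff (Const v) k)))"
    by (simp add: Scalar_def var_s_def var_t_def one_minus_s_neg_pow_def one_minus_t_neg_pow_def
        Const_mult fps_const_power mult_ac flip: fps_const_mult)
  then show ?thesis
    by (simp add: fps_X_power_mult_nth neg_pow_coeff_Const mult_ac flip: Const_mult)
qed

theorem theorem4:
  fixes z :: "nat \<Rightarrow> nat \<Rightarrow> 'a::field_char_0 \<times> 'a"
  shows "has_formal_sum
    (\<lambda>(m, n). Scalar (goncarov z m n)
       * (var_s ^ m * one_minus_s_neg_pow (Const (fst (z m n))) * Scalar (Const (1 / fact m)))
       * (var_t ^ n * one_minus_t_neg_pow (Const (snd (z m n))) * Scalar (Const (1 / fact n))))
    (one_minus_s_neg_pow var_x * one_minus_t_neg_pow var_y)"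
  (is "has_formal_sum ?f ?F")
  unfolding has_formal_sum_def
proof (intro allI)
  fix a b
  let ?c = "\<lambda>i. fps_nth (fps_nth (?f i) b) a"
  let ?T = "{..a} \<times> {..b}"
  \<comment> \<open>The factor s^m t^n excludes every index outside the rectangle, which gives
    finiteness of the support.\<close>
  have sub: "{i. ?c i \<noteq> 0} \<subseteq> ?T"
    by (auto simp: nth_goncarov_term split: if_splits)
  have "fps_nth (fps_nth ?F b) a = neg_pow_coeff var_x a * neg_pow_coeff var_y b"
    by (simp add: one_minus_s_neg_pow_def one_minus_t_neg_pow_def)
  also have "\<dots> = (\<Sum>(i, j)\<in>?T. Const (diff_eval z i j
      (neg_pow_coeff var_x a * neg_pow_coeff var_y b) / (fact i * fact j)) * goncarov z i j)"
    by (rule neg_pow_coeff_expansion)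
  \<comment> \<open>The values of the functionals on the left are exactly the series coefficients on
    the right.\<close>
  also have "\<dots> = (\<Sum>i\<in>?T. ?c i)"
    by (intro sum.cong) (auto simp: nth_goncarov_term diff_eval_neg_pow_coeff)
  \<comment> \<open>Upper factorials of the node coordinates may vanish, so the support can be
    smaller than the rectangle; the extra terms are zero.\<close>
  also have "\<dots> = (\<Sum>i\<in>{i. ?c i \<noteq> 0}. ?c i)"
    using sub by (intro sum.mono_neutral_right) auto
  finally show "finite {i. ?c i \<noteq> 0} \<and>
      fps_nth (fps_nth ?F b) a = (\<Sum>i\<in>{i. ?c i \<noteq> 0}. ?c i)"
    using finite_subset[OF sub] by simp
qed

end
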